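(* Let $k$ and $\ell$ be any positive integers, let $\mathbb{F}$ be a field, and let the sparse, fragmented and approximate lower diagonal matrix $A_k^{\ell-2}$ be written over $\mathbb{F}$ as $$A_k^{\ell-2}=\begin{bmatrix}A_k^{\ell-3}&0&0\\ I_{C^{k+\ell-2}_{\ell-1}}&B&A\end{bmatrix},$$ where $B$ is of order $C^{k+\ell-2}_{\ell-1}\times C^{k+\ell-2}_{\ell-2}$ and $A$ is of order $C^{k+\ell-2}_{\ell-1}\times(C^{k+\ell-1}_{\ell}-C^{k+\ell-1}_{\ell-1})$. Let $\phi=-A_k^{\ell-3}B$, a square matrix of order $C^{k+\ell-2}_{\ell-2}$, which is supposed invertible, it being understood that if it is singular one can simply perform further column permutations to remove this singularity. Let $S\in\mathbb{F}^{\,C^{k+\ell-1}_{\ell}-C^{k+\ell-1}_{\ell-1}}$ be an arbitrary vector, and let $P_1$ and $P_2$ be given by $$P_1^t=\phi^{-1}(A_k^{\ell-3}A)S^t,\qquad P_2^t=-BP_1^t-AS^t.$$ Then $S\mapsto(P_2,P_1,S)$ is an encoder for the regular LDPC code $C_{A_k^{\ell-2}}$.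
   Context: $C^a_b$ denotes the binomial coefficient, $I_p$ the $p\times p$ identity matrix, and $^t$ as a right superscript the transpose. $X(Y)$ is the matrix obtained by pasting $Y$ below $X$ (same number of columns); $X\sqcup Y$ is obtained by placing $Y$ to the right of $X$ with bottom rows aligned and filling the remaining upper right block with zeros (iterated from left to right). $A_k^{-1}$ is the $1\times k$ all-ones row and, for $j\ge0$, $A_k^{j}=A_k^{j-1}(I_{C^{k+j}_{j+1}})\sqcup A_{k-1}^{j-1}(I_{C^{k-1+j}_{j+1}})\sqcup\cdots\sqcup A_1^{j-1}(I_{C^{1+j}_{j+1}})$ (the symbol $A_k^{-2}$, occurring when $\ell=1$, is given no separate definition by the authors). The matrix $A_k^{\ell-2}$ has order $C^{k+\ell-1}_{\ell-1}\times C^{k+\ell-1}_{\ell}$, with $k$ ones in each row and $\ell$ ones in each column; its block form is $A_k^{\ell-3}(I_{C^{k+\ell-2}_{\ell-1}})$ followed by the columns $B\sqcup A=A_{k-1}^{\ell-3}(I_{C^{k+\ell-3}_{\ell-1}})\sqcup\cdots\sqcup A_1^{\ell-3}(I_{C^{\ell-1}_{\ell-1}})$. A sparse matrix is a $(0,1)$-matrix in which most entries are zero. A matrix is in approximate lower diagonal form if it has an identity matrix as a submatrix in its lower left corner. An $n\times m$ matrix $M$ with $m>n$ is fragmented if for some positive integers $r,s$ with $n-s=m-r>0$ it has the form $M=X(Y)\sqcup Z$ with $X$ of order $s\times(m-r)$, $Y$ square of order $(m-r)\times(n-s)$ and $Z$ of order $(n-s)\times r$. For a sparse matrix $H$, the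 parity-check code $C_H=\{x: Hx^t=0\}$ associated with $H$ is called a Low Density Parity Check (LDPC) code; it is regular if $H$ has a fixed number of ones in each row and a fixed number of ones in each column.
   Formalization: Invertibility of φ, possibly after permuting columns right of the identity block, is only assumed: permutations cannot always achieve it (e.g. characteristic 2, ℓ=2). The block form needs k≥ℓ; "sparse" is asserted for ℓ≥3 or ℓ=2, k≥4, and "fragmented" for 2≤ℓ<k, as they fail otherwise. *)

theory Defs
  imports
    "Jordan_Normal_Form.Gauss_Jordan_Elimination"
    "Jordan_Normal_Form.Matrix_Kernel"
    "HOL-Combinatorics.Permutations"
begin

definition append_cols :: "'a :: zero mat \<Rightarrow> 'a mat \<Rightarrow> 'a mat" (infixr "@\<^sub>c" 66) where
  "X @\<^sub>c Y = four_block_mat X Y (0\<^sub>m 0 (dim_col X)) (0\<^sub>m 0 (dim_col Y))"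

(* X(Y) is the library's X @\<^sub>r Y.  X \<squnion> Y: Y to the right of X, bottom rows aligned,
   meaningful when Y has at most as many rows as X. *)
definition join_mat :: "'a :: zero mat \<Rightarrow> 'a mat \<Rightarrow> 'a mat" (infixl "\<squnion>\<^sub>m" 65) where
  "X \<squnion>\<^sub>m Y = X @\<^sub>c (0\<^sub>m (dim_row X - dim_row Y) (dim_col Y) @\<^sub>r Y)"

(* Binomial coefficient with the convention that it vanishes for a negative lower index. *)
definition binom :: "nat \<Rightarrow> int \<Rightarrow> nat" where
  "binom a b = (if b < 0 then 0 else a choose nat b)"

(* The upper index is shifted by two: Amat k l is A_k^(l-2), of order
   binom (k+l-1) (l-1) x binom (k+l-1) l for k > 0.  In particular Amat k 1 is the all-ones row
   A_k^(-1), and the last equation is the recursion for A_k^l in terms of A_i^(l-1), i = k, ..., 1.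
   A_k^(-2) is taken to be the matrix with no rows and one column, which is what the order
   formula gives; with it the recursion also produces A_k^(-1). *)
fun Amat :: "nat \<Rightarrow> nat \<Rightarrow> 'a :: {zero,one} mat" where
  "Amat k 0 = 0\<^sub>m 0 1"
| "Amat k (Suc 0) = mat 1 k (\<lambda>_. 1)"
| "Amat k (Suc (Suc l)) =
     foldl (\<squnion>\<^sub>m) (Amat k (Suc l) @\<^sub>r 1\<^sub>m (k + l choose (l + 1)))
       (map (\<lambda>i. Amat i (Suc l) @\<^sub>r 1\<^sub>m (i + l choose (l + 1))) (rev [1..<k]))"

definition permute_cols :: "(nat \<Rightarrow> nat) \<Rightarrow> 'a mat \<Rightarrow> 'a mat" where
  "permute_cols \<sigma> M = mat (dim_row M) (dim_col M) (\<lambda>(i, j). M $$ (i, \<sigma> j))"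

(* "most entries are zero": more zero than nonzero entries *)
definition sparse_mat :: "'a :: {zero,one} mat \<Rightarrow> bool" where
  "sparse_mat M \<longleftrightarrow> elements_mat M \<subseteq> {0, 1} \<and>
     card {(i, j). i < dim_row M \<and> j < dim_col M \<and> M $$ (i, j) \<noteq> 0}
     < card {(i, j). i < dim_row M \<and> j < dim_col M \<and> M $$ (i, j) = 0}"

definition approx_lower_diagonal :: "'a :: {zero,one} mat \<Rightarrow> bool" where
  "approx_lower_diagonal M \<longleftrightarrow>
     (\<exists>p>0. p \<le> dim_row M \<and> p \<le> dim_col M \<and>
        mat p p (\<lambda>(i, j). M $$ (dim_row M - p + i, j)) = 1\<^sub>m p)"

definition fragmented :: "'a :: zero mat \<Rightarrow> bool" where
  "fragmented M \<longleftrightarrow>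
     (let n = dim_row M; m = dim_col M in
        n < m \<and>
        (\<exists>r s X Y Z. 0 < r \<and> 0 < s \<and> r < m \<and> s < n \<and> n - s = m - r \<and>
           X \<in> carrier_mat s (m - r) \<and> Y \<in> carrier_mat (m - r) (n - s) \<and>
           Z \<in> carrier_mat (n - s) r \<and> M = (X @\<^sub>r Y) \<squnion>\<^sub>m Z))"

definition parity_check_code :: "'a :: field mat \<Rightarrow> 'a vec set" where
  "parity_check_code H = mat_kernel H"

(* a ones in each row, b ones in each column *)
definition regular_mat :: "nat \<Rightarrow> nat \<Rightarrow> 'a :: {zero,one} mat \<Rightarrow> bool" where
  "regular_mat a b M \<longleftrightarrow> elements_mat M \<subseteq> {0, 1} \<and>
     (\<forall>i<dim_row M. card {j. j < dim_col M \<and> M $$ (i, j) = 1} = a) \<and>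
     (\<forall>j<dim_col M. card {i. i < dim_row M \<and> M $$ (i, j) = 1} = b)"

(* The code parity_check_code H is a regular LDPC code; this is a property of H, not of the
   code as a set. *)
definition regular_LDPC :: "nat \<Rightarrow> nat \<Rightarrow> 'a :: {zero,one} mat \<Rightarrow> bool" where
  "regular_LDPC a b H \<longleftrightarrow> sparse_mat H \<and> regular_mat a b H"

(* A linear bijection from the message space F^r onto the code. *)
definition encoder :: "nat \<Rightarrow> ('a :: field vec \<Rightarrow> 'a vec) \<Rightarrow> 'a vec set \<Rightarrow> bool" where
  "encoder r E C \<longleftrightarrow>
     (\<forall>u\<in>carrier_vec r. \<forall>v\<in>carrier_vec r. E (u + v) = E u + E v) \<and>
     (\<forall>c. \<forall>u\<in>carrier_vec r. E (c \<cdot>\<^sub>v u) = c \<cdot>\<^sub>v E u) \<and>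
     bij_betw E (carrier_vec r) C"

end

theory Submission
  imports Defs
begin

text \<open>
  Since pasting to the right is associative on blocks of non-increasing height, all summands but
  the first in the recursion for $A_k^{\ell-2}$ assemble to $A_{k-1}^{\ell-2}$, so that
  $A_k^{\ell-2}$ has block rows $(A_k^{\ell-3}, 0)$ and $(I, A_{k-1}^{\ell-2})$. The order of the
  matrix and the numbers of ones in its rows and columns follow by Pascal's rule and induction.
  The second block row of $H x^t = 0$ gives $P_2^t = -BP_1^t - AS^t$, and substituting this into the
  first one gives $\phi P_1^t = A_k^{\ell-3} A S^t$, so each $S$ extends to exactly one codeword.
  Comparing the number of columns of $H$ with that of the block form forces $\ell \le k$, which
  sparsity needs.
\<close>

section \<open>Entries and associativity of the pasting operations\<close>

lemma index_append_rows [simp]: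
  "i < dim_row X + dim_row Y \<Longrightarrow> j < dim_col X \<Longrightarrow>
    (X @\<^sub>r Y) $$ (i, j) = (if i < dim_row X then X $$ (i, j) else Y $$ (i - dim_row X, j))"
  "dim_row (X @\<^sub>r Y) = dim_row X + dim_row Y"
  "dim_col (X @\<^sub>r Y) = dim_col X"
  by (auto simp: append_rows_def)

lemma index_append_cols [simp]:
  "i < dim_row X \<Longrightarrow> j < dim_col X + dim_col Y \<Longrightarrow>
    (X @\<^sub>c Y) $$ (i, j) = (if j < dim_col X then X $$ (i, j) else Y $$ (i, j - dim_col X))"
  "dim_row (X @\<^sub>c Y) = dim_row X"
  "dim_col (X @\<^sub>c Y) = dim_col X + dim_col Y"
  by (auto simp: append_cols_def)

lemma index_join_mat [simp]:
  "i < dim_row X \<Longrightarrow> j < dim_col X + dim_col Y \<Longrightarrow> dim_row Y \<le> dim_row X \<Longrightarrow>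
    (X \<squnion>\<^sub>m Y) $$ (i, j) =
      (if j < dim_col X then X $$ (i, j)
       else if i < dim_row X - dim_row Y then 0
       else Y $$ (i - (dim_row X - dim_row Y), j - dim_col X))"
  "dim_row (X \<squnion>\<^sub>m Y) = dim_row X"
  "dim_col (X \<squnion>\<^sub>m Y) = dim_col X + dim_col Y"
  by (auto simp: join_mat_def)

text \<open>Either bracketing puts the bottom row of \<open>Z\<close> level with that of
  \<open>X\<close>. A \<open>Z\<close> taller than \<open>Y\<close> would lose its bottom rows in
  the inner join on the right-hand side.\<close>

lemma join_mat_assoc:
  assumes "dim_row Z \<le> dim_row Y" "dim_row Y \<le> dim_row X"
  shows "X \<squnion>\<^sub>m Y \<squnion>\<^sub>m Z = X \<squnion>\<^sub>m (Y \<squnion>\<^sub>m Z)"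
  using assms by (intro eq_matI) (auto simp: not_less diff_diff_eq)

text \<open>The recursion for \<open>Amat\<close> nests joins to the left; splitting off the first
  summand lets the rest be recognised as a member of the same family.\<close>

lemma foldl_join_mat_assoc:
  assumes "dim_row Y \<le> dim_row X" "\<forall>Z \<in> set Zs. dim_row Z \<le> dim_row Y"
  shows "foldl (\<squnion>\<^sub>m) (X \<squnion>\<^sub>m Y) Zs = X \<squnion>\<^sub>m foldl (\<squnion>\<^sub>m) Y Zs"
  using assms by (induction Zs arbitrary: Y) (auto simp: join_mat_assoc)

lemma append_rows_join_mat:
  assumes "dim_row Z = dim_row Y" "dim_col X = dim_col Y"
  shows "(X @\<^sub>r Y) \<squnion>\<^sub>m Z = four_block_mat X (0\<^sub>m (dim_row X) (dim_col Z)) Y Z"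
  using assms by (intro eq_matI) (auto simp: not_less)

lemma dim_foldl_join_mat:
  "dim_row (foldl (\<squnion>\<^sub>m) X Zs) = dim_row X"
  by (induction Zs arbitrary: X) auto

section \<open>Block form and order of \<open>Amat\<close>\<close>

lemma Amat_0:
  "Amat 0 (Suc l) \<in> carrier_mat 1 0"
  by (induction l) (auto simp: append_rows_def)

text \<open>The order one level down is assumed because \<open>Amat_carrier\<close>, itself proved
  with this block form, has it only as an induction hypothesis.\<close>

lemma Amat_four_block:
  assumes dims: "\<And>i. (Amat i (Suc l) :: 'a :: {zero,one} mat) \<in> carrier_mat (i + l choose l) (i + l choose Suc l)"
  shows "(Amat (Suc k) (Suc (Suc l)) :: 'a mat) =
    four_block_mat (Amat (Suc k) (Suc l))
      (0\<^sub>m (Suc k + l choose l) (dim_col (Amat k (Suc (Suc l)) :: 'a mat)))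
      (1\<^sub>m (Suc k + l choose Suc l)) (Amat k (Suc (Suc l)))"
proof -
  define C :: "nat \<Rightarrow> 'a mat" where "C i = Amat i (Suc l) @\<^sub>r 1\<^sub>m (i + l choose Suc l)" for i
  have dim_C: "dim_row (C i) = (Suc i + l choose Suc l)" for i
    using dims[of i] by (auto simp: C_def)
  \<comment> \<open>The recursion lists its indices downwards, so this is the non-increasing height
    that associativity requires.\<close>
  have mono: "dim_row (C i) \<le> dim_row (C j)" if "i \<le> j" for i j
    unfolding dim_C using that by (intro binomial_right_mono) simp
  have unfold: "Amat i (Suc (Suc l)) = foldl (\<squnion>\<^sub>m) (C i) (map C (rev [1..<i]))" for i
    by (simp add: C_def[abs_def])
  have row: "dim_row (Amat k (Suc (Suc l)) :: 'a mat) = (Suc k + l choose Suc l)"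
    by (simp only: unfold dim_foldl_join_mat dim_C)
  have "Amat (Suc k) (Suc (Suc l)) = C (Suc k) \<squnion>\<^sub>m Amat k (Suc (Suc l))"
  proof (cases "k = 0")
    case True
    \<comment> \<open>At index 1 there is no second summand, and the matrix of index 0 has no
      columns, so pasting it changes nothing.\<close>
    have "C (Suc 0) = C (Suc 0) \<squnion>\<^sub>m Amat 0 (Suc (Suc l))"
      using Amat_0[of "Suc l", where 'a = 'a] by (intro eq_matI) (auto simp: dim_C simp del: Amat.simps)
    thus ?thesis unfolding True unfold[of "Suc 0"] by simp
  next
    case False
    hence "rev [1..<Suc k] = k # rev [1..<k]" by simp
    hence "Amat (Suc k) (Suc (Suc l)) = foldl (\<squnion>\<^sub>m) (C (Suc k) \<squnion>\<^sub>m C k) (map C (rev [1..<k]))"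
      by (simp only: unfold list.map foldl.simps)
    also have "\<dots> = C (Suc k) \<squnion>\<^sub>m Amat k (Suc (Suc l))"
      unfolding unfold[of k] by (rule foldl_join_mat_assoc) (auto intro!: mono)
    finally show ?thesis .
  qed
  thus ?thesis
    unfolding C_def using dims[of "Suc k"] row
    by (subst (asm) append_rows_join_mat) (auto simp del: Amat.simps)
qed

text \<open>The block form reduces the pair (k+1, l+2) to (k+1, l+1) and (k, l+2). Hence an
  induction on k inside one on l, the outer hypothesis being available for every k.\<close>

lemma Amat_carrier:
  "Amat k (Suc l) \<in> carrier_mat (k + l choose l) (k + l choose Suc l)"
proof (induction l arbitrary: k)
  case (Suc l)
  note carrier = Suc.IH
  show ?case
  proof (induction k)
    case 0
    show ?case using Amat_0[of "Suc l"] by (simp add: binomial_eq_0 del: Amat.simps)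
  next
    case (Suc k)
    show ?case
      unfolding Amat_four_block[OF carrier] using carrier[of "Suc k"] Suc
      by (intro carrier_matI) (auto simp del: Amat.simps)
  qed
qed auto

section \<open>Numbers of ones in rows and columns\<close>

lemma elements_mat_subset_iff:
  "elements_mat M \<subseteq> S \<longleftrightarrow> (\<forall>i<dim_row M. \<forall>j<dim_col M. M $$ (i, j) \<in> S)"
  by (force simp: elements_mat_def)

text \<open>The identity adds one to the \<open>a\<close> ones of a row of \<open>Q\<close> and to
  the \<open>b\<close> ones of a column of \<open>P\<close>; rows of \<open>P\<close> and columns of
  \<open>Q\<close> are extended by zeros only.\<close>

lemma regular_mat_four_block:
  fixes P Q :: "'a :: zero_neq_one mat"
  assumes P: "P \<in> carrier_mat p q" "regular_mat (Suc a) b P"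
    and Q: "Q \<in> carrier_mat q r" "regular_mat a (Suc b) Q"
  shows "regular_mat (Suc a) (Suc b) (four_block_mat P (0\<^sub>m p r) (1\<^sub>m q) Q)"
    (is "regular_mat _ _ ?M")
  unfolding regular_mat_def elements_mat_subset_iff
proof (intro conjI allI impI)
  have [simp]: "dim_row P = p" "dim_col P = q" "dim_row Q = q" "dim_col Q = r"
    using P Q by auto
  show "?M $$ (i, j) \<in> {0, 1}" if "i < dim_row ?M" "j < dim_col ?M" for i j
    using that P(2) Q(2) by (auto simp: regular_mat_def elements_mat_subset_iff one_mat_def)
  show "card {j. j < dim_col ?M \<and> ?M $$ (i, j) = 1} = Suc a" if i: "i < dim_row ?M" for i
  proof (cases "i < p")
    case True
    hence "{j. j < dim_col ?M \<and> ?M $$ (i, j) = 1} = {j. j < q \<and> P $$ (i, j) = 1}"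
      by (auto split: if_splits)
    thus ?thesis using True P(2) by (simp add: regular_mat_def)
  next
    case False
    have "j \<in> (+) q ` X \<longleftrightarrow> q \<le> j \<and> j - q \<in> X" for j X
      by (auto simp: image_iff intro: bexI[of _ "j - q"])
    \<comment> \<open>The ones of \<open>Q\<close> move \<open>q\<close> columns to the right, and
      the identity contributes column \<open>i - p\<close>, which lies to the left of all of
      them.\<close>
    hence "{j. j < dim_col ?M \<and> ?M $$ (i, j) = 1}
        = insert (i - p) ((+) q ` {j. j < r \<and> Q $$ (i - p, j) = 1})"
      using i False by (auto simp: one_mat_def split: if_splits)
    moreover have "i - p \<notin> (+) q ` {j. j < r \<and> Q $$ (i - p, j) = 1}" using i False by auto
    ultimately show ?thesis
      using i False Q(2) by (simp add: regular_mat_def card_image)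
  qed
  show "card {i. i < dim_row ?M \<and> ?M $$ (i, j) = 1} = Suc b" if j: "j < dim_col ?M" for j
  proof (cases "j < q")
    case True
    hence "{i. i < dim_row ?M \<and> ?M $$ (i, j) = 1} = insert (p + j) {i. i < p \<and> P $$ (i, j) = 1}"
      by (auto simp: one_mat_def split: if_splits)
    thus ?thesis using True P(2) by (simp add: regular_mat_def)
  next
    case False
    have "i \<in> (+) p ` X \<longleftrightarrow> p \<le> i \<and> i - p \<in> X" for i X
      by (auto simp: image_iff intro: bexI[of _ "i - p"])
    hence "{i. i < dim_row ?M \<and> ?M $$ (i, j) = 1} = (+) p ` {i. i < q \<and> Q $$ (i, j - q) = 1}"
      using j False by (auto split: if_splits)
    thus ?thesis using j False Q(2) by (simp add: regular_mat_def card_image)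
  qed
qed

text \<open>The same double induction as for the order: the blocks have weights (k+1, l+1) and (k,
  l+2), the pattern that \<open>regular_mat_four_block\<close> turns into (k+1, l+2).\<close>

lemma regular_Amat:
  "regular_mat k (Suc l) (Amat k (Suc l) :: 'a :: zero_neq_one mat)"
proof (induction l arbitrary: k)
  case 0
  show ?case by (simp add: regular_mat_def elements_mat_subset_iff cong: conj_cong)
next
  case (Suc l)
  note regular = Suc.IH
  show ?case
  proof (induction k)
    case 0
    show ?case
      using Amat_0[of "Suc l", where 'a = 'a]
      by (auto simp: regular_mat_def elements_mat_subset_iff simp del: Amat.simps)
  next
    case (Suc k)
    have dims: "(Amat (Suc k) (Suc l) :: 'a mat) \<in>
        carrier_mat (Suc k + l choose l) (Suc k + l choose Suc l)"
      "(Amat k (Suc (Suc l)) :: 'a mat) \<in>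
        carrier_mat (Suc k + l choose Suc l) (dim_col (Amat k (Suc (Suc l)) :: 'a mat))"
      using Amat_carrier[of "Suc k" l, where 'a = 'a] Amat_carrier[of k "Suc l", where 'a = 'a]
      by (auto simp del: Amat.simps)
    show ?case
      unfolding Amat_four_block[OF Amat_carrier]
      using dims regular[of "Suc k"] Suc by (intro regular_mat_four_block)
  qed
qed

text \<open>Columns are only moved, so their counts persist; for a row, \<sigma> is a bijection
  between the positions of its ones after and before the permutation.\<close>

lemma regular_mat_permute_cols:
  fixes M :: "'a :: zero_neq_one mat"
  assumes \<sigma>: "\<sigma> permutes {..<dim_col M}" and M: "regular_mat a b M"
  shows "regular_mat a b (permute_cols \<sigma> M)"
proof -
  have less: "\<sigma> j < dim_col M \<longleftrightarrow> j < dim_col M" for j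
    using permutes_in_image[OF \<sigma>, of j] by simp
  have "card {j. j < dim_col M \<and> M $$ (i, \<sigma> j) = 1} = card {j. j < dim_col M \<and> M $$ (i, j) = 1}"
    for i
  proof -
    have "bij_betw \<sigma> {j. j < dim_col M \<and> M $$ (i, \<sigma> j) = 1} {j. j < dim_col M \<and> M $$ (i, j) = 1}"
      unfolding bij_betw_def
    proof
      show "inj_on \<sigma> {j. j < dim_col M \<and> M $$ (i, \<sigma> j) = 1}"
        using permutes_inj_on[OF \<sigma>] .
      show "\<sigma> ` {j. j < dim_col M \<and> M $$ (i, \<sigma> j) = 1} = {j. j < dim_col M \<and> M $$ (i, j) = 1}"
        using less permutes_surj[OF \<sigma>] by (auto simp: image_iff) (metis surjD)
    qed
    thus ?thesis by (rule bij_betw_same_card)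
  qed
  thus ?thesis
    using M less by (auto simp: regular_mat_def elements_mat_subset_iff permute_cols_def cong: conj_cong)
qed

section \<open>Sparsity by counting ones\<close>

lemma sparse_regular_mat:
  fixes M :: "'a :: zero_neq_one mat"
  assumes M: "regular_mat a b M" and "0 < dim_row M" and "2 * a < dim_col M"
  shows "sparse_mat M"
proof -
  let ?n = "dim_row M" and ?m = "dim_col M"
  let ?N = "{(i, j). i < ?n \<and> j < ?m \<and> M $$ (i, j) \<noteq> 0}"
  let ?Z = "{(i, j). i < ?n \<and> j < ?m \<and> M $$ (i, j) = 0}"
  \<comment> \<open>All entries are 0 or 1, so the nonzero ones can be counted row by row,
    \<open>a\<close> in each.\<close>
  have "?N = (SIGMA i:{..<?n}. {j. j < ?m \<and> M $$ (i, j) = 1})"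
    using M by (auto simp: regular_mat_def elements_mat_subset_iff)
  hence N: "card ?N = ?n * a"
    using M by (simp add: card_SigmaI regular_mat_def)
  have "finite ({..<?n} \<times> {..<?m})" by simp
  hence fin: "finite ?N" "finite ?Z" by (rule rev_finite_subset; auto)+
  have "?N \<union> ?Z = {..<?n} \<times> {..<?m}" by auto
  hence "card ?N + card ?Z = ?n * ?m"
    using fin by (subst card_Un_disjoint[symmetric]) (auto simp: card_cartesian_product)
  moreover have "2 * (?n * a) < ?n * ?m" using assms(2,3) by (simp add: mult.left_commute)
  ultimately have "card ?N < card ?Z" unfolding N by linarith
  thus ?thesis using M by (simp add: sparse_mat_def regular_mat_def)
qed

text \<open>This compares the row weight k with the number of columns of \<open>Amat k l\<close>.
  For l = 2 the bound on k is sharp: k = 3 gives 6 columns, exactly twice the weight.\<close>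

lemma double_less_binomial:
  assumes "(3 \<le> l \<and> l \<le> k) \<or> (l = 2 \<and> 4 \<le> k)"
  shows "2 * k < (k + l - 1 choose l)"
  using assms
proof
  assume l: "3 \<le> l \<and> l \<le> k"
  have "3 \<le> k" using l by simp
  hence "2 * k < (k + 2 choose 3)"
    by (induction k rule: dec_induct) (simp_all add: numeral_eq_Suc)
  \<comment> \<open>With the lower index k - 1, free of l, the coefficient grows with its upper
    index, so the case l = 3 suffices.\<close>
  also have "\<dots> = (k + 2 choose (k - 1))"
    using \<open>3 \<le> k\<close> by (subst binomial_symmetric) auto
  also have "\<dots> \<le> (k + l - 1 choose (k - 1))"
    using l by (intro binomial_right_mono) auto
  also have "\<dots> = (k + l - 1 choose l)"
    using l by (subst binomial_symmetric) auto
  finally show ?thesis .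
next
  assume l: "l = 2 \<and> 4 \<le> k"
  hence "4 \<le> k" by simp
  hence "2 * k < (k + 1 choose 2)"
    by (induction k rule: dec_induct) (simp_all add: numeral_eq_Suc)
  thus ?thesis using l by simp
qed

section \<open>Solving the block system and encoding\<close>

lemma append_cols_mult_vec:
  fixes X Y :: "'a :: comm_ring_1 mat"
  assumes X: "X \<in> carrier_mat n a" and Y: "Y \<in> carrier_mat n b"
    and u: "u \<in> carrier_vec a" and v: "v \<in> carrier_vec b"
  shows "(X @\<^sub>c Y) *\<^sub>v (u @\<^sub>v v) = X *\<^sub>v u + Y *\<^sub>v v"
proof -
  have "(X @\<^sub>c Y) *\<^sub>v (u @\<^sub>v v)
      = (X *\<^sub>v u + Y *\<^sub>v v) @\<^sub>v (0\<^sub>m 0 a *\<^sub>v u + 0\<^sub>m 0 b *\<^sub>v v)"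
    using four_block_mat_mult_vec[OF X Y _ _ u v, of "0\<^sub>m 0 a" 0 "0\<^sub>m 0 b"] X Y
    by (simp add: append_cols_def)
  also have "\<dots> = X *\<^sub>v u + Y *\<^sub>v v" using Y by (intro eq_vecI) auto
  finally show ?thesis .
qed

lemma zero_mat_mult_vec: "v \<in> carrier_vec m \<Longrightarrow> 0\<^sub>m n m *\<^sub>v v = 0\<^sub>v n"
  by (intro eq_vecI) auto

lemma smult_append_vec: "c \<cdot>\<^sub>v (u @\<^sub>v v) = c \<cdot>\<^sub>v u @\<^sub>v c \<cdot>\<^sub>v v"
  by (intro eq_vecI) auto

text \<open>Elimination of \<open>x\<close> through the identity block is reversible. Both
  directions matter: encoded words must lie in the code, and every codeword must be encoded.\<close>

lemma block_mult_vec_eq_0_iff: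
  fixes A A' B :: "'a :: comm_ring_1 mat"
  assumes A': "A' \<in> carrier_mat p q" and B: "B \<in> carrier_mat q p" and A: "A \<in> carrier_mat q r"
    and x: "x \<in> carrier_vec q" and y: "y \<in> carrier_vec p" and z: "z \<in> carrier_vec r"
  shows "((A' @\<^sub>c 0\<^sub>m p p @\<^sub>c 0\<^sub>m p r) @\<^sub>r (1\<^sub>m q @\<^sub>c B @\<^sub>c A))
      *\<^sub>v (x @\<^sub>v y @\<^sub>v z) = 0\<^sub>v (p + q)
    \<longleftrightarrow> x = - (B *\<^sub>v y) - A *\<^sub>v z \<and> - (A' * B) *\<^sub>v y = (A' * A) *\<^sub>v z"
proof -
  have carrier: "0\<^sub>m p p @\<^sub>c 0\<^sub>m p r \<in> carrier_mat p (p + r)"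
    "B @\<^sub>c A \<in> carrier_mat q (p + r)"
    "A' @\<^sub>c 0\<^sub>m p p @\<^sub>c 0\<^sub>m p r \<in> carrier_mat p (q + (p + r))"
    "1\<^sub>m q @\<^sub>c B @\<^sub>c A \<in> carrier_mat q (q + (p + r))"
    using A' B A by (auto intro!: carrier_matI)
  have yz: "y @\<^sub>v z \<in> carrier_vec (p + r)" and xyz: "x @\<^sub>v y @\<^sub>v z \<in> carrier_vec (q + (p + r))"
    using x y z by auto
  have top: "(A' @\<^sub>c 0\<^sub>m p p @\<^sub>c 0\<^sub>m p r) *\<^sub>v (x @\<^sub>v y @\<^sub>v z) = A' *\<^sub>v x"
    using A' x y z
    by (simp add: append_cols_mult_vec[OF A' carrier(1) x yz]
        append_cols_mult_vec[OF zero_carrier_mat zero_carrier_mat y z] zero_mat_mult_vec)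
  have bot: "(1\<^sub>m q @\<^sub>c B @\<^sub>c A) *\<^sub>v (x @\<^sub>v y @\<^sub>v z) = x + (B *\<^sub>v y + A *\<^sub>v z)"
    using x by (simp add: append_cols_mult_vec[OF one_carrier_mat carrier(2) x yz]
        append_cols_mult_vec[OF B A y z])
  have zero: "0\<^sub>v (p + q) = 0\<^sub>v p @\<^sub>v (0\<^sub>v q :: 'a vec)" by (intro eq_vecI) auto
  have By: "B *\<^sub>v y \<in> carrier_vec q" and Az: "A *\<^sub>v z \<in> carrier_vec q"
    using A B y z by auto
  have "x + (B *\<^sub>v y + A *\<^sub>v z) = 0\<^sub>v q \<longleftrightarrow> x = - (B *\<^sub>v y) - A *\<^sub>v z"
  proof
    assume eq: "x + (B *\<^sub>v y + A *\<^sub>v z) = 0\<^sub>v q"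
    show "x = - (B *\<^sub>v y) - A *\<^sub>v z"
    proof (intro eq_vecI)
      fix i assume "i < dim_vec (- (B *\<^sub>v y) - A *\<^sub>v z)"
      hence i: "i < q" using A by simp
      have "(x + (B *\<^sub>v y + A *\<^sub>v z)) $ i = 0" using i by (simp add: eq)
      hence "x $ i + ((B *\<^sub>v y) $ i + (A *\<^sub>v z) $ i) = 0"
        using i x carrier_vecD[OF By] carrier_vecD[OF Az] by (simp del: index_mult_mat_vec)
      hence "x $ i = - (B *\<^sub>v y) $ i - (A *\<^sub>v z) $ i"
        by (simp add: eq_neg_iff_add_eq_0[symmetric] del: index_mult_mat_vec)
      thus "x $ i = (- (B *\<^sub>v y) - A *\<^sub>v z) $ i"
        using i carrier_vecD[OF By] carrier_vecD[OF Az] by (simp del: index_mult_mat_vec)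
    qed (use x A in auto)
  next
    assume "x = - (B *\<^sub>v y) - A *\<^sub>v z"
    thus "x + (B *\<^sub>v y + A *\<^sub>v z) = 0\<^sub>v q" using A B by (intro eq_vecI) auto
  qed
  moreover have "A' *\<^sub>v (- (B *\<^sub>v y) - A *\<^sub>v z) = 0\<^sub>v p \<longleftrightarrow> - (A' * B) *\<^sub>v y = (A' * A) *\<^sub>v z"
  proof -
    have "A' *\<^sub>v (- (B *\<^sub>v y)) = - (A' * B) *\<^sub>v y"
      using A' B y by (intro eq_vecI) auto
    hence "A' *\<^sub>v (- (B *\<^sub>v y) - A *\<^sub>v z) = - (A' * B) *\<^sub>v y - (A' * A) *\<^sub>v z"
      using A' B A y z by (simp add: mult_minus_distrib_mat_vec[OF A'])
    moreover have "u - v = 0\<^sub>v p \<longleftrightarrow> u = v" if "u \<in> carrier_vec p" "v \<in> carrier_vec p" for u v :: "'a vec"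
      using that by (auto simp: vec_eq_iff)
    ultimately show ?thesis using A' B A y z by simp
  qed
  ultimately show ?thesis
    unfolding mat_mult_append[OF carrier(3,4) xyz] top bot zero
    using A' x by (auto simp: append_vec_eq[of _ p])
qed

text \<open>The bridge from the existential \<open>invertible_mat\<close> to the computed
  \<open>mat_inverse\<close>: an invertible matrix is a unit of the matrix ring, which excludes the
  result \<open>None\<close>.\<close>

lemma mat_inverse_eq_SomeE:
  fixes M :: "'a :: field mat"
  assumes M: "M \<in> carrier_mat n n" and "invertible_mat M"
  obtains N where "mat_inverse M = Some N" "M * N = 1\<^sub>m n" "N * M = 1\<^sub>m n" "N \<in> carrier_mat n n"
proof -
  obtain N where N: "M * N = 1\<^sub>m n" "N * M = 1\<^sub>m (dim_row N)"
    using assms by (auto simp: invertible_mat_def inverts_mat_def)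
  \<comment> \<open>\<open>invertible_mat\<close> does not state the order of the inverse; it is
    read off from the identity matrices on the right.\<close>
  have "dim_col N = n" using arg_cong[OF N(1), of dim_col] by simp
  moreover have "dim_row N = n" using arg_cong[OF N(2), of dim_col] M by simp
  ultimately have "M \<in> Units (ring_mat TYPE('a) n ())"
    using M N by (auto simp: Units_def ring_mat_def intro!: exI[of _ N])
  hence "mat_inverse M \<noteq> None" using mat_inverse(1)[OF M, where b = "()"] by blast
  thus thesis using mat_inverse(2)[OF M] that by blast
qed

text \<open>On messages, \<open>P\<^sub>1\<close> and \<open>P\<^sub>2\<close> act as fixed matrices
  \<open>T\<close> and \<open>U\<close>, which gives linearity. Bijectivity holds because a codeword
  is determined by its last \<open>r\<close> coordinates, which are free.\<close>

lemma encoder_block_kernel: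
  fixes A A' B :: "'a :: field mat"
  assumes A': "A' \<in> carrier_mat p q" and B: "B \<in> carrier_mat q p" and A: "A \<in> carrier_mat q r"
    and inv: "invertible_mat (- (A' * B))"
    and P1: "\<And>S. S \<in> carrier_vec r \<Longrightarrow> P\<^sub>1 S = the (mat_inverse (- (A' * B))) *\<^sub>v ((A' * A) *\<^sub>v S)"
    and P2: "\<And>S. S \<in> carrier_vec r \<Longrightarrow> P\<^sub>2 S = - (B *\<^sub>v P\<^sub>1 S) - A *\<^sub>v S"
  shows "encoder r (\<lambda>S. P\<^sub>2 S @\<^sub>v P\<^sub>1 S @\<^sub>v S)
    (mat_kernel ((A' @\<^sub>c 0\<^sub>m p p @\<^sub>c 0\<^sub>m p r) @\<^sub>r (1\<^sub>m q @\<^sub>c B @\<^sub>c A)))"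
proof -
  let ?E = "\<lambda>S. P\<^sub>2 S @\<^sub>v P\<^sub>1 S @\<^sub>v S"
  let ?H = "(A' @\<^sub>c 0\<^sub>m p p @\<^sub>c 0\<^sub>m p r) @\<^sub>r (1\<^sub>m q @\<^sub>c B @\<^sub>c A)"
  define \<phi> where "\<phi> = - (A' * B)"
  have \<phi>: "\<phi> \<in> carrier_mat p p" using A' B by (simp add: \<phi>_def)
  then obtain \<psi> where some: "mat_inverse \<phi> = Some \<psi>" and \<psi>: "\<psi> \<in> carrier_mat p p"
    and inverse: "\<phi> * \<psi> = 1\<^sub>m p" "\<psi> * \<phi> = 1\<^sub>m p"
    using inv by (auto simp: \<phi>_def[symmetric] elim: mat_inverse_eq_SomeE)
  define T where "T = \<psi> * (A' * A)"
  have T: "T \<in> carrier_mat p r" using \<psi> A' A by (simp add: T_def)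
  have P1_T: "P\<^sub>1 S = T *\<^sub>v S" if "S \<in> carrier_vec r" for S
    using assoc_mult_mat_vec[OF \<psi> mult_carrier_mat[OF A' A] that] that
    by (simp add: P1 T_def \<phi>_def[symmetric] some)
  define U where "U = - (B * T) - A"
  have U: "U \<in> carrier_mat q r" using A by (simp add: U_def minus_carrier_mat)
  have P2_U: "P\<^sub>2 S = U *\<^sub>v S" if "S \<in> carrier_vec r" for S
    using that A B T
    by (simp add: P2 P1_T U_def minus_mult_distrib_mat_vec[of _ q r])
  have E_carrier: "P\<^sub>1 S \<in> carrier_vec p" "P\<^sub>2 S \<in> carrier_vec q" if "S \<in> carrier_vec r" for S
    using that T U by (auto simp: P1_T P2_U)
  have H: "?H \<in> carrier_mat (p + q) (q + (p + r))"
    using A' B A by (auto intro!: carrier_matI)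
  have solve: "\<phi> *\<^sub>v y = (A' * A) *\<^sub>v S \<longleftrightarrow> y = P\<^sub>1 S"
    if S: "S \<in> carrier_vec r" and y: "y \<in> carrier_vec p" for S y
  proof
    assume eq: "\<phi> *\<^sub>v y = (A' * A) *\<^sub>v S"
    have "y = (\<psi> * \<phi>) *\<^sub>v y" using y by (simp add: inverse)
    also have "\<dots> = \<psi> *\<^sub>v (\<phi> *\<^sub>v y)" using \<psi> \<phi> y by (rule assoc_mult_mat_vec)
    finally show "y = P\<^sub>1 S" using S by (simp add: eq P1 \<phi>_def[symmetric] some)
  next
    have rhs: "(A' * A) *\<^sub>v S \<in> carrier_vec p" using A' A S by auto
    assume "y = P\<^sub>1 S"
    hence "\<phi> *\<^sub>v y = (\<phi> * \<psi>) *\<^sub>v ((A' * A) *\<^sub>v S)"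
      using \<phi> \<psi> rhs S by (simp add: P1 \<phi>_def[symmetric] some)
    thus "\<phi> *\<^sub>v y = (A' * A) *\<^sub>v S" using rhs by (simp add: inverse)
  qed
  have kernel_iff: "x @\<^sub>v y @\<^sub>v z \<in> mat_kernel ?H \<longleftrightarrow> x = P\<^sub>2 z \<and> y = P\<^sub>1 z"
    if "x \<in> carrier_vec q" "y \<in> carrier_vec p" "z \<in> carrier_vec r" for x y z
    using that block_mult_vec_eq_0_iff[OF A' B A that] solve[OF that(3,2)] P2[OF that(3)]
    by (auto simp: mat_kernel[OF H] \<phi>_def)
  have "?E (u + v) = ?E u + ?E v" if "u \<in> carrier_vec r" "v \<in> carrier_vec r" for u v
    using that T U E_carrier[OF that(1)] E_carrier[OF that(2)]
    by (simp add: append_vec_add[of _ q _ _ "p + r"] append_vec_add[of _ p _ _ r] P1_T P2_U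
        mult_add_distrib_mat_vec)
  moreover have "?E (c \<cdot>\<^sub>v u) = c \<cdot>\<^sub>v ?E u" if "u \<in> carrier_vec r" for c u
    using that T U by (simp add: smult_append_vec P1_T P2_U mult_mat_vec)
  moreover have "bij_betw ?E (carrier_vec r) (mat_kernel ?H)"
    unfolding bij_betw_def
  proof
    show "inj_on ?E (carrier_vec r)"
      using E_carrier by (auto simp: inj_on_def append_vec_eq[of _ q] append_vec_eq[of _ p])
    show "?E ` carrier_vec r = mat_kernel ?H"
    proof
      show "?E ` carrier_vec r \<subseteq> mat_kernel ?H" using E_carrier kernel_iff by auto
      show "mat_kernel ?H \<subseteq> ?E ` carrier_vec r"
      proof
        fix w assume w: "w \<in> mat_kernel ?H"
        hence dim: "w \<in> carrier_vec (q + (p + r))" using H by (rule mat_kernelD(1)[rotated])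
        \<comment> \<open>The cuts after \<open>q\<close> and \<open>q + p\<close> coordinates
          recover the three components of an encoded word.\<close>
        define x y z where "x = vec_first w q" and "y = vec_first (vec_last w (p + r)) p"
          and "z = vec_last (vec_last w (p + r)) r"
        have split: "w = x @\<^sub>v y @\<^sub>v z" using dim by (simp add: x_def y_def z_def)
        have "x \<in> carrier_vec q" "y \<in> carrier_vec p" and z: "z \<in> carrier_vec r"
          by (simp_all add: x_def y_def z_def)
        hence "w = ?E z" using kernel_iff w split by simp
        thus "w \<in> ?E ` carrier_vec r" using z by blast
      qed
    qed
  qed
  ultimately show ?thesis unfolding encoder_def by blast
qed

section \<open>The theorem for the permuted matrix\<close>

theorem theorem7p7:
  fixes k l p q r :: nat
    and \<sigma> :: "nat \<Rightarrow> nat"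
    and H A' B A \<phi> :: "'a :: field mat"
    and P\<^sub>1 P\<^sub>2 :: "'a vec \<Rightarrow> 'a vec"
  assumes "k > 0" and "l > 0"
    and p: "p = binom (k + l - 2) (int l - 2)"
    and q: "q = (k + l - 2 choose (l - 1))"
    and r: "r = (k + l - 1 choose l) - (k + l - 1 choose (l - 1))"
    and \<sigma>: "\<sigma> permutes {q..<(k + l - 1 choose l)}"
    and H: "H = permute_cols \<sigma> (Amat k l)"
    and A': "A' = Amat k (l - 1)"
    and B: "B \<in> carrier_mat q p"
    and A: "A \<in> carrier_mat q r"
    and block: "H = (A' @\<^sub>c 0\<^sub>m p p @\<^sub>c 0\<^sub>m p r) @\<^sub>r (1\<^sub>m q @\<^sub>c B @\<^sub>c A)"
    and \<phi>: "\<phi> = - (A' * B)" and "invertible_mat \<phi>"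
    and P1: "\<And>S. S \<in> carrier_vec r \<Longrightarrow> P\<^sub>1 S = the (mat_inverse \<phi>) *\<^sub>v ((A' * A) *\<^sub>v S)"
    and P2: "\<And>S. S \<in> carrier_vec r \<Longrightarrow> P\<^sub>2 S = - (B *\<^sub>v P\<^sub>1 S) - A *\<^sub>v S"
  shows "encoder r (\<lambda>S. P\<^sub>2 S @\<^sub>v P\<^sub>1 S @\<^sub>v S) (parity_check_code H)
    \<and> regular_mat k l H
    \<and> approx_lower_diagonal H
    \<and> (2 \<le> l \<and> l < k \<longrightarrow> fragmented H)
    \<and> (3 \<le> l \<or> (l = 2 \<and> 4 \<le> k) \<longrightarrow> regular_LDPC k l H)"
proof -
  let ?m = "k + l - 1 choose l"
  obtain l' where l': "l = Suc l'" using \<open>l > 0\<close> by (cases l) auto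
  have dims: "(Amat k l :: 'a mat) \<in> carrier_mat (k + l - 1 choose (l - 1)) ?m"
    using Amat_carrier[of k l'] by (simp add: l' del: Amat.simps)
  have A': "A' \<in> carrier_mat p q"
  proof (cases l')
    \<comment> \<open>Here l = 1: the negative lower index makes \<open>p = 0\<close>, and
      \<open>A'\<close> is the matrix with no rows and one column.\<close>
    case 0
    thus ?thesis by (simp add: A' p q l' binom_def)
  next
    case (Suc n)
    have "nat (int l - 2) = n" using l' Suc by simp
    thus ?thesis
      using Amat_carrier[of k n, where 'a = 'a] l' Suc
      by (simp add: A' p q binom_def del: Amat.simps)
  qed
  \<comment> \<open>The order of \<open>H\<close> is computed twice, from the block form and from
    \<open>Amat\<close>; comparing the two yields \<open>pq\<close> and then l \<le> k.\<close>
  have dim_H: "dim_row H = p + q" "dim_col H = q + (p + r)"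
    unfolding block using A' B A by auto
  have dim_H': "dim_row H = (k + l - 1 choose (l - 1))" "dim_col H = ?m"
    unfolding H using dims by (auto simp: permute_cols_def)
  have "q > 0" using \<open>k > 0\<close> by (simp add: q)
  have pq: "p + q = (k + l - 1 choose (l - 1))" using dim_H(1) dim_H'(1) by simp
  have "l \<le> k"
  proof (rule ccontr)
    assume "\<not> l \<le> k"
    \<comment> \<open>Past the middle the coefficients decrease, so the truncated difference
      \<open>r\<close> is 0 and the block form would have too many columns.\<close>
    hence "(k + l - 1 choose l) < (k + l - 1 choose (l - 1))"
      by (intro binomial_strict_antimono) (use \<open>k > 0\<close> \<open>l > 0\<close> in auto)
    thus False using dim_H(2) dim_H'(2) pq by simp
  qed
  have perm: "\<sigma> permutes {..<?m}" using \<sigma> by (rule permutes_subset) auto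
  have regular: "regular_mat k l H"
    unfolding H using regular_Amat[of k l', where 'a = 'a] perm dims
    by (intro regular_mat_permute_cols) (auto simp: l' simp del: Amat.simps)
  have "approx_lower_diagonal H"
    unfolding approx_lower_diagonal_def
  proof (intro exI[of _ q] conjI)
    show "mat q q (\<lambda>(i, j). H $$ (dim_row H - q + i, j)) = 1\<^sub>m q"
      unfolding dim_H block using A' B A by (intro eq_matI) auto
  qed (use \<open>q > 0\<close> dim_H in auto)
  moreover have "fragmented H" if "2 \<le> l \<and> l < k"
  proof -
    have "p > 0" using that by (simp add: p binom_def nat_diff_distrib)
    \<comment> \<open>For l = k the two coefficients agree and \<open>H\<close> would be square; l <
      k makes the inequality strict.\<close>
    have "r > 0"
      unfolding r zero_less_diff by (intro binomial_strict_mono) (use that in auto)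
    have "H = (A' @\<^sub>r 1\<^sub>m q) \<squnion>\<^sub>m (B @\<^sub>c A)"
      unfolding block using A' B A by (intro eq_matI) auto
    moreover have "B @\<^sub>c A \<in> carrier_mat q (p + r)"
      using A B by (intro carrier_matI) auto
    ultimately have "A' \<in> carrier_mat p q \<and> 1\<^sub>m q \<in> carrier_mat q q
        \<and> B @\<^sub>c A \<in> carrier_mat q (p + r) \<and> H = (A' @\<^sub>r 1\<^sub>m q) \<squnion>\<^sub>m (B @\<^sub>c A)"
      using A' by simp
    \<comment> \<open>The witnesses for r and s in \<open>fragmented\<close> are
      \<open>p + r\<close> and \<open>p\<close>, so both differences equal \<open>q\<close>. The
      orders are left as differences to match the definition literally.\<close>
    hence "0 < p + r \<and> 0 < p \<and> p + r < q + (p + r) \<and> p < p + q \<and> p + q - p = q + (p + r) - (p + r)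
        \<and> A' \<in> carrier_mat p (q + (p + r) - (p + r))
        \<and> 1\<^sub>m q \<in> carrier_mat (q + (p + r) - (p + r)) (p + q - p)
        \<and> B @\<^sub>c A \<in> carrier_mat (p + q - p) (p + r) \<and> H = (A' @\<^sub>r 1\<^sub>m q) \<squnion>\<^sub>m (B @\<^sub>c A)"
      using \<open>p > 0\<close> \<open>q > 0\<close> by (simp only: add_diff_cancel_left' add_diff_cancel_right') simp
    moreover have "p + q < q + (p + r)" using \<open>r > 0\<close> by simp
    ultimately show ?thesis
      unfolding fragmented_def Let_def dim_H by blast
  qed
  moreover have "regular_LDPC k l H" if "3 \<le> l \<or> (l = 2 \<and> 4 \<le> k)"
    unfolding regular_LDPC_def
  proof
    \<comment> \<open>Each of the rows, of length \<open>?m\<close>, has k ones, so fewer than half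
      of the entries are nonzero.\<close>
    have "2 * k < ?m" using that \<open>l \<le> k\<close> by (intro double_less_binomial) auto
    thus "sparse_mat H"
      using regular \<open>q > 0\<close> dim_H(1) dim_H'(2) by (intro sparse_regular_mat) auto
  qed (rule regular)
  moreover have "encoder r (\<lambda>S. P\<^sub>2 S @\<^sub>v P\<^sub>1 S @\<^sub>v S) (parity_check_code H)"
    unfolding parity_check_code_def block
    using A' B A \<open>invertible_mat \<phi>\<close> P1 P2 unfolding \<phi> by (rule encoder_block_kernel)
  ultimately show ?thesis using regular by blast
qed

end
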